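(* Let $\mathbf s=(s_1,\dots,s_n)$ be a composition of a positive integer, let $\mathrm{oru}(\mathbf s)$ be the graph on vertex set $[n+1]$ with $s_i+1$ parallel edges from $i$ to $i+1$ for each $i\in[n]$, and let $F$ be the framing induced by a planar drawing of $\mathrm{oru}(\mathbf s)$. Then the framing lattice $\mathscr L_{\mathrm{oru}(\mathbf s),F}$ is isomorphic to the lattice of multipermutations $\mathscr M_{\mathbf s}$.
   Context: A flow graph $G$ is a finite directed acyclic multigraph with linearly ordered vertices, edges directed from smaller to larger vertices, a unique source $s$ and unique sink $t$; a route is a directed $s$–$t$ path. A framing $F$ gives at each vertex $v$ linear orders $\le_{\mathrm{In}(v)}$, $\le_{\mathrm{Out}(v)}$ on entering and leaving edges. For a path $P$ through $v$, $Pv$ (resp. $vP$) is the maximal subpath of $P$ ending (resp. starting) at $v$. For $Pv,Qv$, let $w$ be the first vertex after which they coincide; if $w$ is the first vertex of one of them they are equal, else $Pv<_{\mathscr I(v)}Qv$ iff $P$'s edge entering $w$ precedes $Q$'s in $\le_{\mathrm{In}(w)}$. Dually for $vP,vQ$ with $w'$ the last vertex before which they coincide, using $\le_{\mathrm{Out}(w')}$, giving $<_{\mathscr O(v)}$. For paths $P,Q$ with common inner vertex $v$, $P<_v^{cw}Q$ means $Pv<_{\mathscr I(v)}Qv$ and $vQ<_{\mathscr O(v)}vP$; they are incoherent at $v$ if $P<_v^{cw}Q$ or $Q<_v^{cw}P$, coherent if incoherent at no common inner vertex. A clique is a set of pairwise coherent routes. For maximal cliques, $C\lessdot C'$ if $C'=(C\setminus\{R\})\cup\{R'\}$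 with $R<_u^{cw}R'$ for some $u$; the framing lattice $\mathscr L_{G,F}$ is the set of maximal cliques with the reflexive-transitive closure of $\lessdot$. The framing induced by a planar drawing (vertices $1,\dots,n+1$ left to right on a line, parallel edges between $i$ and $i+1$ drawn without crossings) orders, at each vertex, incoming edges from top to bottom and outgoing edges from top to bottom; thus the parallel edges from $i$ to $i+1$ appear in the same order in $\le_{\mathrm{Out}(i)}$ and $\le_{\mathrm{In}(i+1)}$. The lattice of multipermutations $\mathscr M_{\mathbf s}$ is the poset on all words (multipermutations) containing exactly $s_i$ copies of $i$ for each $i\in[n]$, generated by the cover relations $\mu_1\lessdot\mu_2$ whenever $\mu_2$ is obtained from $\mu_1$ by replacing two adjacent letters $ab$ with $a<b$ by $ba$. *)

theory Defs
  imports Complex_Main "Graph_Theory.Kuratowski" "HOL-Algebra.Order"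
begin

section \<open>Flow graphs, routes and framings\<close>

definition is_source :: "('a, 'b) pre_digraph \<Rightarrow> 'a \<Rightarrow> bool" where
  "is_source G v \<longleftrightarrow> v \<in> verts G \<and> in_arcs G v = {}"

definition is_sink :: "('a, 'b) pre_digraph \<Rightarrow> 'a \<Rightarrow> bool" where
  "is_sink G v \<longleftrightarrow> v \<in> verts G \<and> out_arcs G v = {}"

text \<open>Acyclicity follows from arcs being directed from smaller to larger vertices.\<close>

locale flow_graph = fin_digraph G for G :: "('a::linorder, 'b) pre_digraph" (structure) +
  assumes increasing: "e \<in> arcs G \<Longrightarrow> tail G e < head G e"
    and unique_source: "\<exists>!v. is_source G v"
    and unique_sink: "\<exists>!v. is_sink G v"

definition route :: "('a, 'b) pre_digraph \<Rightarrow> 'b list \<Rightarrow> bool" where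
  "route G P \<longleftrightarrow> (\<exists>u w. is_source G u \<and> is_sink G w \<and> pre_digraph.apath G u P w)"

text \<open>\<open>(e, f) \<in> in_ord F v\<close> means that \<open>e\<close> weakly precedes \<open>f\<close> among the arcs entering \<open>v\<close>;
  similarly for \<open>out_ord\<close> and the arcs leaving \<open>v\<close>.\<close>

record ('a, 'b) framing =
  in_ord :: "'a \<Rightarrow> 'b rel"
  out_ord :: "'a \<Rightarrow> 'b rel"

definition is_framing :: "('a, 'b) pre_digraph \<Rightarrow> ('a, 'b) framing \<Rightarrow> bool" where
  "is_framing G F \<longleftrightarrow> (\<forall>v \<in> verts G.
     linear_order_on (in_arcs G v) (in_ord F v) \<and> linear_order_on (out_arcs G v) (out_ord F v))"

section \<open>Coherence\<close>

text \<open>For a path \<open>P\<close> through \<open>v\<close>, given by its list of arcs, these are \<open>Pv\<close> and \<open>vP\<close>.\<close>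

definition path_to :: "('a, 'b) pre_digraph \<Rightarrow> 'a \<Rightarrow> 'b list \<Rightarrow> 'b list" where
  "path_to G v P = takeWhile (\<lambda>e. tail G e \<noteq> v) P"

definition path_from :: "('a, 'b) pre_digraph \<Rightarrow> 'a \<Rightarrow> 'b list \<Rightarrow> 'b list" where
  "path_from G v P = dropWhile (\<lambda>e. tail G e \<noteq> v) P"

text \<open>In \<open>in_less\<close>, \<open>C\<close> is the longest common final segment of \<open>Pv\<close> and \<open>Qv\<close>, so
  \<open>head G e = head G f\<close> is the first vertex after which they coincide. When that vertex is the
  first vertex of \<open>Pv\<close> or of \<open>Qv\<close>, there is no such decomposition and neither is smaller.
  Dually, in \<open>out_less\<close>, \<open>C\<close> is the longest common initial segment of \<open>vP\<close> and \<open>vQ\<close>.\<close>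

definition in_less ::
  "('a, 'b) pre_digraph \<Rightarrow> ('a, 'b) framing \<Rightarrow> 'a \<Rightarrow> 'b list \<Rightarrow> 'b list \<Rightarrow> bool" where
  "in_less G F v P Q \<longleftrightarrow> (\<exists>A B C e f.
     path_to G v P = A @ e # C \<and> path_to G v Q = B @ f # C \<and>
     e \<noteq> f \<and> head G e = head G f \<and> (e, f) \<in> in_ord F (head G e))"

definition out_less ::
  "('a, 'b) pre_digraph \<Rightarrow> ('a, 'b) framing \<Rightarrow> 'a \<Rightarrow> 'b list \<Rightarrow> 'b list \<Rightarrow> bool" where
  "out_less G F v P Q \<longleftrightarrow> (\<exists>A B C e f.
     path_from G v P = C @ e # A \<and> path_from G v Q = C @ f # B \<and>
     e \<noteq> f \<and> tail G e = tail G f \<and> (e, f) \<in> out_ord F (tail G e))"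

definition cw_less ::
  "('a, 'b) pre_digraph \<Rightarrow> ('a, 'b) framing \<Rightarrow> 'a \<Rightarrow> 'b list \<Rightarrow> 'b list \<Rightarrow> bool" where
  "cw_less G F v P Q \<longleftrightarrow>
     v \<in> set (pre_digraph.inner_verts G P) \<and> v \<in> set (pre_digraph.inner_verts G Q) \<and>
     in_less G F v P Q \<and> out_less G F v Q P"

definition coherent :: "('a, 'b) pre_digraph \<Rightarrow> ('a, 'b) framing \<Rightarrow> 'b list \<Rightarrow> 'b list \<Rightarrow> bool" where
  "coherent G F P Q \<longleftrightarrow> \<not> (\<exists>v. cw_less G F v P Q \<or> cw_less G F v Q P)"

section \<open>The framing lattice\<close>

definition clique :: "('a, 'b) pre_digraph \<Rightarrow> ('a, 'b) framing \<Rightarrow> 'b list set \<Rightarrow> bool" where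
  "clique G F C \<longleftrightarrow> (\<forall>P \<in> C. route G P) \<and> (\<forall>P \<in> C. \<forall>Q \<in> C. coherent G F P Q)"

definition max_clique :: "('a, 'b) pre_digraph \<Rightarrow> ('a, 'b) framing \<Rightarrow> 'b list set \<Rightarrow> bool" where
  "max_clique G F C \<longleftrightarrow> clique G F C \<and> (\<forall>D. clique G F D \<and> C \<subseteq> D \<longrightarrow> D = C)"

definition clique_cover ::
  "('a, 'b) pre_digraph \<Rightarrow> ('a, 'b) framing \<Rightarrow> 'b list set \<Rightarrow> 'b list set \<Rightarrow> bool" where
  "clique_cover G F C C' \<longleftrightarrow> max_clique G F C \<and> max_clique G F C' \<and>
     (\<exists>R \<in> C. \<exists>R' u. C' = (C - {R}) \<union> {R'} \<and> cw_less G F u R R')"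

definition framing_lattice ::
  "('a, 'b) pre_digraph \<Rightarrow> ('a, 'b) framing \<Rightarrow> 'b list set gorder" where
  "framing_lattice G F =
     \<lparr>carrier = {C. max_clique G F C}, eq = (=), le = (clique_cover G F)\<^sup>*\<^sup>*\<rparr>"

section \<open>Planar drawings\<close>

text \<open>Vertex \<open>v\<close> is drawn at the point \<open>(v, 0)\<close>, and arc \<open>e\<close> as the graph of the function \<open>d e\<close>
  over the interval from its tail to its head. Distinct arcs may meet only in common end points,
  and no arc passes through a vertex.\<close>

definition planar_drawing :: "(nat, 'b) pre_digraph \<Rightarrow> ('b \<Rightarrow> real \<Rightarrow> real) \<Rightarrow> bool" where
  "planar_drawing G d \<longleftrightarrow>
     (\<forall>e \<in> arcs G.
        continuous_on {real (tail G e)..real (head G e)} (d e) \<and>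
        d e (real (tail G e)) = 0 \<and> d e (real (head G e)) = 0 \<and>
        (\<forall>v \<in> verts G. tail G e < v \<and> v < head G e \<longrightarrow> d e (real v) \<noteq> 0)) \<and>
     (\<forall>e \<in> arcs G. \<forall>f \<in> arcs G. \<forall>x. e \<noteq> f \<and>
        real (tail G e) < x \<and> x < real (head G e) \<and> real (tail G f) < x \<and> x < real (head G f)
        \<longrightarrow> d e x \<noteq> d f x)"

text \<open>The arcs at a vertex are ordered from top to bottom: \<open>e\<close> precedes \<open>f\<close> if it is drawn
  above \<open>f\<close> near the vertex.\<close>

definition drawing_framing ::
  "(nat, 'b) pre_digraph \<Rightarrow> ('b \<Rightarrow> real \<Rightarrow> real) \<Rightarrow> (nat, 'b) framing" where
  "drawing_framing G d =
     \<lparr>in_ord = (\<lambda>v. {(e, f). e \<in> in_arcs G v \<and> f \<in> in_arcs G v \<and>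
        (e = f \<or> (\<forall>\<^sub>F x in at_left (real v). d f x < d e x))}),
      out_ord = (\<lambda>v. {(e, f). e \<in> out_arcs G v \<and> f \<in> out_arcs G v \<and>
        (e = f \<or> (\<forall>\<^sub>F x in at_right (real v). d f x < d e x))})\<rparr>"

section \<open>The graph \<open>oru(s)\<close> and multipermutations\<close>

definition composition :: "nat \<Rightarrow> nat \<Rightarrow> (nat \<Rightarrow> nat) \<Rightarrow> bool" where
  "composition N n s \<longleftrightarrow> (\<forall>i \<in> {1..n}. 0 < s i) \<and> (\<Sum>i = 1..n. s i) = N"

text \<open>The arcs from \<open>i\<close> to \<open>i + 1\<close> are the pairs \<open>(i, j)\<close> with \<open>0 \<le> j \<le> s i\<close>. The label \<open>j\<close>
  carries no information about the position of the arc in a drawing.\<close>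

definition oru :: "nat \<Rightarrow> (nat \<Rightarrow> nat) \<Rightarrow> (nat, nat \<times> nat) pre_digraph" where
  "oru n s = \<lparr>verts = {1..n + 1}, arcs = (SIGMA i : {1..n}. {0..s i}),
     tail = fst, head = (\<lambda>e. fst e + 1)\<rparr>"

definition multipermutations :: "nat \<Rightarrow> (nat \<Rightarrow> nat) \<Rightarrow> nat list set" where
  "multipermutations n s = {w. set w \<subseteq> {1..n} \<and> (\<forall>i \<in> {1..n}. count_list w i = s i)}"

definition ascent_swap :: "nat list \<Rightarrow> nat list \<Rightarrow> bool" where
  "ascent_swap \<mu> \<nu> \<longleftrightarrow> (\<exists>x y a b. a < b \<and> \<mu> = x @ [a, b] @ y \<and> \<nu> = x @ [b, a] @ y)"

definition multipermutation_lattice :: "nat \<Rightarrow> (nat \<Rightarrow> nat) \<Rightarrow> nat list gorder" where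
  "multipermutation_lattice n s =
     \<lparr>carrier = multipermutations n s, eq = (=), le = ascent_swap\<^sup>*\<^sup>*\<rparr>"

text \<open>An isomorphism of posets, which is the same as an isomorphism of lattices when they
  are lattices. Note that \<open>order_emb\<close> includes that both sides are partial orders.\<close>

definition order_isomorphic :: "'a gorder \<Rightarrow> 'b gorder \<Rightarrow> bool" where
  "order_isomorphic L M \<longleftrightarrow> (\<exists>\<phi>. bij_betw \<phi> (carrier L) (carrier M) \<and> order_emb L M \<phi>)"

section \<open>Well-formedness\<close>

lemma flow_graph_oru:
  assumes "0 < n"
  shows "flow_graph (oru n s)"
proof -
  have src: "is_source (oru n s) v \<longleftrightarrow> v = 1" for v
  proof
    assume *: "is_source (oru n s) v"
    show "v = 1"
    proof (rule ccontr)
      assume "v \<noteq> 1"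
      with * have "(v - 1, 0) \<in> in_arcs (oru n s) v"
        by (auto simp: is_source_def oru_def in_arcs_def)
      with * show False by (auto simp: is_source_def)
    qed
  qed (auto simp: is_source_def oru_def in_arcs_def)
  have snk: "is_sink (oru n s) v \<longleftrightarrow> v = n + 1" for v
  proof
    assume *: "is_sink (oru n s) v"
    show "v = n + 1"
    proof (rule ccontr)
      assume "v \<noteq> n + 1"
      with * have "(v, 0) \<in> out_arcs (oru n s) v"
        by (auto simp: is_sink_def oru_def out_arcs_def)
      with * show False by (auto simp: is_sink_def)
    qed
  qed (auto simp: is_sink_def oru_def out_arcs_def)
  show ?thesis
    by unfold_locales (auto simp: src snk, auto simp: oru_def)
qed

lemma planar_drawing_oru_exists: "\<exists>d. planar_drawing (oru n s) d"
proof -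
  let ?d = "\<lambda>(e :: nat \<times> nat) x :: real.
    real (snd e) * (x - real (fst e)) * (real (fst e) + 1 - x)"
  have "?d e x \<noteq> ?d f x" if "e \<noteq> f" "real (fst e) < x" "x < real (fst e) + 1"
      "real (fst f) < x" "x < real (fst f) + 1" for e f x
  proof -
    have eq: "fst e = fst f" using that by linarith
    with that(1) have "snd e \<noteq> snd f" by (simp add: prod_eq_iff)
    moreover have "x - real (fst f) \<noteq> 0" "real (fst f) + 1 - x \<noteq> 0" using that by auto
    ultimately show ?thesis unfolding eq by simp
  qed
  then have "planar_drawing (oru n s) ?d"
    unfolding planar_drawing_def by (auto simp: oru_def algebra_simps intro!: continuous_intros)
  then show ?thesis by (intro exI[where x = ?d])
qed

lemma no_crossing_sign:
  fixes g :: "real \<Rightarrow> real"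
  assumes "continuous_on {a<..<b} g" "\<And>x. a < x \<Longrightarrow> x < b \<Longrightarrow> g x \<noteq> 0"
  shows "(\<forall>x. a < x \<and> x < b \<longrightarrow> g x < 0) \<or> (\<forall>x. a < x \<and> x < b \<longrightarrow> 0 < g x)"
proof (rule ccontr)
  assume "\<not> ?thesis"
  then obtain x y where xy: "x \<in> {a<..<b}" "y \<in> {a<..<b}" "g x < 0" "0 < g y"
    using assms(2) by (metis greaterThanLessThan_iff linorder_neqE_linordered_idom)
  have "Topological_Spaces.connected (g ` {a<..<b})"
    using assms(1) connected_Ioo by (rule connected_continuous_image)
  then have "0 \<in> g ` {a<..<b}"
    using xy unfolding connected_iff_interval by (meson image_eqI less_imp_le)
  with assms(2) show False by auto
qed

lemma linear_order_from_eventually: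
  fixes d :: "'b \<Rightarrow> real \<Rightarrow> real"
  assumes nt: "Fl \<noteq> bot"
    and total: "\<And>e f. e \<in> A \<Longrightarrow> f \<in> A \<Longrightarrow> e \<noteq> f \<Longrightarrow>
      (\<forall>\<^sub>F x in Fl. d f x < d e x) \<or> (\<forall>\<^sub>F x in Fl. d e x < d f x)"
  shows "linear_order_on A {(e, f). e \<in> A \<and> f \<in> A \<and> (e = f \<or> (\<forall>\<^sub>F x in Fl. d f x < d e x))}"
proof -
  have asym: False if "\<forall>\<^sub>F x in Fl. d f x < d e x" "\<forall>\<^sub>F x in Fl. d e x < d f x" for e f
  proof -
    have "\<forall>\<^sub>F x in Fl. False" using that by eventually_elim auto
    with nt show False by simp
  qed
  have trans: "\<forall>\<^sub>F x in Fl. d g x < d e x"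
    if "\<forall>\<^sub>F x in Fl. d f x < d e x" "\<forall>\<^sub>F x in Fl. d g x < d f x" for e f g
    using that by eventually_elim auto
  show ?thesis
    unfolding linear_order_on_def partial_order_on_def preorder_on_def
    by (auto simp: refl_on_def total_on_def intro!: transI antisymI dest: asym trans total)
qed

lemma is_framing_drawing_framing:
  assumes G: "flow_graph G" and d: "planar_drawing G d"
  shows "is_framing G (drawing_framing G d)"
proof -
  interpret flow_graph G by (rule G)
  have sign: "(\<forall>x. a < x \<and> x < b \<longrightarrow> d f x < d e x) \<or> (\<forall>x. a < x \<and> x < b \<longrightarrow> d e x < d f x)"
    if ef: "e \<in> arcs G" "f \<in> arcs G" "e \<noteq> f"
      and a: "a = max (real (tail G e)) (real (tail G f))"
      and b: "b = min (real (head G e)) (real (head G f))" for e f a b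
  proof -
    have "continuous_on {a<..<b} (\<lambda>x. d e x - d f x)"
    proof (intro continuous_on_diff)
      show "continuous_on {a<..<b} (d e)"
        by (rule continuous_on_subset[of "{real (tail G e)..real (head G e)}"])
          (use d ef a b in \<open>auto simp: planar_drawing_def\<close>)
      show "continuous_on {a<..<b} (d f)"
        by (rule continuous_on_subset[of "{real (tail G f)..real (head G f)}"])
          (use d ef a b in \<open>auto simp: planar_drawing_def\<close>)
    qed
    moreover have "d e x - d f x \<noteq> 0" if "a < x" "x < b" for x
      using d ef a b that by (auto simp: planar_drawing_def)
    ultimately show ?thesis
      using no_crossing_sign[of a b "\<lambda>x. d e x - d f x"] by auto
  qed
  have "linear_order_on (in_arcs G v) (in_ord (drawing_framing G d) v)" for v
  proof -
    have "(\<forall>\<^sub>F x in at_left (real v). d f x < d e x) \<or> (\<forall>\<^sub>F x in at_left (real v). d e x < d f x)"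
      if "e \<in> in_arcs G v" "f \<in> in_arcs G v" "e \<noteq> f" for e f
    proof -
      let ?a = "max (real (tail G e)) (real (tail G f))"
      have "?a < real v" using that increasing[of e] increasing[of f] by (auto simp: in_arcs_def)
      then have "\<forall>\<^sub>F x in at_left (real v). ?a < x \<and> x < real v"
        using eventually_at_left_real[of ?a "real v"] by (auto elim: eventually_mono)
      moreover have "(\<forall>x. ?a < x \<and> x < real v \<longrightarrow> d f x < d e x) \<or> (\<forall>x. ?a < x \<and> x < real v \<longrightarrow> d e x < d f x)"
        by (rule sign) (use that in \<open>auto simp: in_arcs_def\<close>)
      ultimately show ?thesis
        by (elim disjE) (rule disjI1, erule eventually_mono, blast, rule disjI2, erule eventually_mono, blast)
    qed
    then show ?thesis
      unfolding drawing_framing_def framing.simps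
      by (intro linear_order_from_eventually) simp_all
  qed
  moreover have "linear_order_on (out_arcs G v) (out_ord (drawing_framing G d) v)" for v
  proof -
    have "(\<forall>\<^sub>F x in at_right (real v). d f x < d e x) \<or> (\<forall>\<^sub>F x in at_right (real v). d e x < d f x)"
      if "e \<in> out_arcs G v" "f \<in> out_arcs G v" "e \<noteq> f" for e f
    proof -
      let ?b = "min (real (head G e)) (real (head G f))"
      have "real v < ?b" using that increasing[of e] increasing[of f] by (auto simp: out_arcs_def)
      then have "\<forall>\<^sub>F x in at_right (real v). real v < x \<and> x < ?b"
        using eventually_at_right_real[of "real v" ?b] by (auto elim: eventually_mono)
      moreover have "(\<forall>x. real v < x \<and> x < ?b \<longrightarrow> d f x < d e x) \<or> (\<forall>x. real v < x \<and> x < ?b \<longrightarrow> d e x < d f x)"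
        by (rule sign) (use that in \<open>auto simp: out_arcs_def\<close>)
      ultimately show ?thesis
        by (elim disjE) (rule disjI1, erule eventually_mono, blast, rule disjI2, erule eventually_mono, blast)
    qed
    then show ?thesis
      unfolding drawing_framing_def framing.simps
      by (intro linear_order_from_eventually) simp_all
  qed
  ultimately show ?thesis by (simp add: is_framing_def)
qed

end

theory Submission
  imports Defs
begin

text \<open>A route of \<open>oru(s)\<close> chooses one of \<open>s i + 1\<close> linearly ordered arcs for each \<open>i\<close>, so it is a
  point of a product of chains, that is, a submultiset of the multiset with \<open>s i\<close> copies of each \<open>i\<close>.
  Two routes are incoherent if and only if their points are incomparable: between two coordinates
  in which they differ in opposite directions there are two such coordinates with no difference
  in between. Hence maximal cliques are maximal chains of submultisets, and
  the elements added along such a chain spell a multipermutation. Exchanging one member of a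
  maximal chain swaps two adjacent letters, and the exchange is clockwise if and only if these
  form an ascent.\<close>

section \<open>Maximal chains below a multiset\<close>

abbreviation mset_chain :: "'a multiset \<Rightarrow> 'a multiset set \<Rightarrow> bool" where
  "mset_chain T \<equiv> pred_on.chain {M. M \<subseteq># T} (\<subseteq>#)"

abbreviation mset_maxchain :: "'a multiset \<Rightarrow> 'a multiset set \<Rightarrow> bool" where
  "mset_maxchain T \<equiv> pred_on.maxchain {M. M \<subseteq># T} (\<subseteq>#)"

lemma mset_chain_iff:
  "mset_chain T C \<longleftrightarrow> (\<forall>M \<in> C. M \<subseteq># T) \<and> (\<forall>M \<in> C. \<forall>N \<in> C. M \<subseteq># N \<or> N \<subseteq># M)"
  by (auto simp: pred_on.chain_def)

text \<open>Indices beyond the length only repeat \<open>mset w\<close>, so no bound on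
  \<open>k\<close> is imposed. The trace is the saturated chain from the empty multiset up to
  \<open>mset w\<close> that adds the letters of \<open>w\<close> one at a time.\<close>

definition trace :: "'a list \<Rightarrow> 'a multiset set" where
  "trace w = range (\<lambda>k. mset (take k w))"

text \<open>A prefix of length \<open>k\<close> has size \<open>k\<close>, so the size of
  \<open>M\<close> tells which prefix it has to be compared with.\<close>

lemma trace_iff: "M \<in> trace w \<longleftrightarrow> M = mset (take (size M) w)"
proof
  assume "M \<in> trace w"
  then obtain k where "M = mset (take k w)"
    by (auto simp: trace_def)
  then show "M = mset (take (size M) w)"
    by (cases "k \<le> length w") (simp_all add: min_def)
qed (auto simp: trace_def)

lemma trace_comparable:
  assumes "M \<in> trace w" "N \<in> trace w"
  shows "M \<subseteq># N \<or> N \<subseteq># M"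
proof -
  have *: "mset (take i w) \<subseteq># mset (take j w)" if "i \<le> j" for i j
  proof -
    have "take j w = take i w @ drop i (take j w)"
      using that by (metis append_take_drop_id min.absorb1 take_take)
    then show ?thesis
      by (metis mset_append mset_subset_eq_add_left)
  qed
  obtain i j where "M = mset (take i w)" "N = mset (take j w)"
    using assms by (auto simp: trace_def)
  then show ?thesis
    using *[of i j] *[of j i] by (cases "i \<le> j") auto
qed

lemma mset_chain_trace: "mset_chain (mset w) (trace w)"
proof -
  have "mset (take k w) \<subseteq># mset w" for k
    by (metis append_take_drop_id mset_append mset_subset_eq_add_left)
  then have "\<forall>M \<in> trace w. M \<subseteq># mset w"
    by (simp add: trace_def)
  then show ?thesis
    by (simp add: mset_chain_iff trace_comparable)
qed

text \<open>An element of a chain is determined by its size, so nothing can be added to a trace, which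
  has elements of all sizes.\<close>

lemma mem_trace_if_comparable:
  assumes "M \<subseteq># mset w" "\<forall>N \<in> trace w. M \<subseteq># N \<or> N \<subseteq># M"
  shows "M \<in> trace w"
proof -
  let ?N = "mset (take (size M) w)"
  have "size M \<le> length w"
    using size_mset_mono[OF assms(1)] by simp
  then have "size ?N = size M"
    by simp
  moreover have "M \<subseteq># ?N \<or> ?N \<subseteq># M"
    using assms(2) by (auto simp: trace_def)
  ultimately have "M = ?N"
    by (metis mset_subset_size nless_le subset_mset.nless_le)
  then show ?thesis
    by (simp add: trace_iff)
qed

lemma mset_maxchain_trace: "mset_maxchain (mset w) (trace w)"
proof -
  have "D \<subseteq> trace w" if "mset_chain (mset w) D" "trace w \<subseteq> D" for D
  proof
    fix M assume "M \<in> D"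
    with that show "M \<in> trace w"
      by (intro mem_trace_if_comparable) (auto simp: mset_chain_iff)
  qed
  then show ?thesis
    unfolding pred_on.maxchain_def using mset_chain_trace by blast
qed

text \<open>Comparable multisets of equal size are equal, so \<open>size\<close> embeds a chain into
  \<open>{..size T}\<close>.\<close>

lemma mset_chain_finite:
  assumes "mset_chain T C" shows "finite C"
proof (rule finite_imageD)
  show "finite (size ` C)"
    by (rule finite_subset[of _ "{..size T}"])
      (use assms size_mset_mono in \<open>auto simp: mset_chain_iff\<close>)
  show "inj_on size C"
    using assms mset_subset_size unfolding mset_chain_iff inj_on_def
    by (metis less_irrefl subset_mset.le_less)
qed

lemma trace_append_subset: "trace u \<subseteq> trace (u @ v)"
proof
  fix M assume M: "M \<in> trace u"
  then have "M \<subseteq># mset u"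
    using mset_chain_trace by (auto simp: mset_chain_iff)
  then have "size M \<le> length u"
    using size_mset_mono by fastforce
  then show "M \<in> trace (u @ v)"
    using M by (simp add: trace_iff)
qed

text \<open>Induction removes the largest member \<open>M\<close>. The rest is a chain below
  \<open>M\<close>, hence lies in the trace of a word spelling \<open>M\<close>, and any word
  spelling \<open>T - M\<close> may be appended to it.\<close>

lemma mset_chain_subset_trace:
  assumes "finite C" "mset_chain T C"
  shows "\<exists>w. mset w = T \<and> C \<subseteq> trace w"
  using assms
proof (induction C arbitrary: T rule: finite_psubset_induct)
  case (psubset C)
  show ?case
  proof (cases "C = {}")
    case True
    then show ?thesis
      using ex_mset by auto
  next
    case False
    then have "Max (size ` C) \<in> size ` C"
      using psubset.hyps by (intro Max_in) auto
    then obtain M where M: "M \<in> C" "size M = Max (size ` C)"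
      by auto
    have le: "N \<subseteq># M" if "N \<in> C" for N
    proof -
      have "size N \<le> size M"
        unfolding M(2) using psubset.hyps that by (intro Max_ge) auto
      then have "\<not> M \<subset># N"
        using mset_subset_size by (meson not_le)
      then show ?thesis
        using psubset.prems M(1) that by (auto simp: mset_chain_iff subset_mset.less_le)
    qed
    \<comment> \<open>The upper bound drops from \<open>T\<close> to \<open>M\<close>, which is why
      \<open>T\<close> is arbitrary in the induction.\<close>
    have "mset_chain M (C - {M})"
      using psubset.prems le by (auto simp: mset_chain_iff)
    then obtain w where w: "mset w = M" "C - {M} \<subseteq> trace w"
      using psubset.IH[of "C - {M}" M] M(1) by blast
    obtain u where u: "mset u = T - M"
      using ex_mset by blast
    \<comment> \<open>\<open>M\<close> is the last element of this trace, the multiset of the whole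
      word.\<close>
    have "M \<in> trace w"
      using w(1) by (auto simp: trace_iff simp flip: size_mset)
    with w have "C \<subseteq> trace (w @ u)"
      using trace_append_subset by fastforce
    moreover have "mset (w @ u) = T"
      using w u M psubset.prems by (auto simp: mset_chain_iff)
    ultimately show ?thesis
      by blast
  qed
qed

text \<open>The letter at position \<open>k\<close> is the difference of the prefix multisets of
  lengths \<open>k\<close> and \<open>Suc k\<close>.\<close>

lemma nth_eq_if_mset_take_eq:
  assumes "k < length w" "k < length w'"
    and "mset (take k w) = mset (take k w')" "mset (take (Suc k) w) = mset (take (Suc k) w')"
  shows "w ! k = w' ! k"
  using assms by (simp add: take_Suc_conv_app_nth)

text \<open>A trace has one multiset of each size up to the common length, so it determines all
  prefix multisets and with them the letters.\<close>

lemma inj_on_trace: "inj_on trace {w. mset w = T}"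
proof
  fix w w' :: "'a list"
  assume T: "w \<in> {w. mset w = T}" "w' \<in> {w. mset w = T}" and eq: "trace w = trace w'"
  then have len: "length w = length w'"
    by (metis (lifting) mem_Collect_eq size_mset)
  have "mset (take k w) = mset (take k w')" if "k \<le> length w" for k
  proof -
    have "mset (take k w) \<in> trace w'"
      using eq by (auto simp: trace_def)
    then show ?thesis
      using that by (simp add: trace_iff)
  qed
  then show "w = w'"
    using len by (intro nth_equalityI nth_eq_if_mset_take_eq) auto
qed

text \<open>For surjectivity, a maximal chain lies in some trace, and since the trace is itself a
  chain, maximality makes the two equal.\<close>

lemma bij_betw_trace: "bij_betw trace {w. mset w = T} {C. mset_maxchain T C}"
proof (rule bij_betw_imageI[OF inj_on_trace])
  have "C \<in> trace ` {w. mset w = T}" if "mset_maxchain T C" for C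
  proof -
    have "mset_chain T C"
      using that by (auto simp: pred_on.maxchain_def)
    then obtain w where w: "mset w = T" "C \<subseteq> trace w"
      using mset_chain_subset_trace mset_chain_finite by blast
    then have "C = trace w"
      using that mset_chain_trace by (auto simp: pred_on.maxchain_def)
    with w show ?thesis by blast
  qed
  then show "trace ` {w. mset w = T} = {C. mset_maxchain T C}"
    using mset_maxchain_trace by auto
qed

section \<open>Incomparable multisets and the clockwise relation\<close>

text \<open>The counterpart of \<open>cw_less\<close> for multisets: \<open>i\<close> stands for the
  last difference of two routes before a common vertex and \<open>j\<close> for the first one after
  it. Agreement in between replaces the vertex.\<close>

definition clockwise :: "'a::linorder multiset \<Rightarrow> 'a multiset \<Rightarrow> bool" where
  "clockwise M N \<longleftrightarrow> (\<exists>i j. i < j \<and> count N i < count M i \<and> count M j < count N j \<and>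
     (\<forall>k. i < k \<and> k < j \<longrightarrow> count M k = count N k))"

text \<open>Induction on the gap: a coordinate \<open>k\<close> in between at which the counts
  differ can take the place of \<open>i\<close> or of \<open>j\<close>, according to the sign of the
  difference.\<close>

lemma clockwise_if_opposite:
  fixes M N :: "nat multiset"
  assumes "i < j" "count N i < count M i" "count M j < count N j"
  shows "clockwise M N"
  using assms
proof (induction "j - i" arbitrary: i j rule: less_induct)
  case less
  show ?case
  proof (cases "\<forall>k. i < k \<and> k < j \<longrightarrow> count M k = count N k")
    case True
    with less.prems show ?thesis
      by (auto simp: clockwise_def)
  next
    case False
    then obtain k where k: "i < k" "k < j" "count M k \<noteq> count N k"
      by blast
    then consider "count N k < count M k" | "count M k < count N k"
      by linarith
    then show ?thesis
      using less.hyps[of j k] less.hyps[of k i] less.prems k by cases auto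
  qed
qed

text \<open>Each of two incomparable multisets exceeds the other somewhere, and the order of these
  two coordinates decides the direction.\<close>

lemma comparable_iff_not_clockwise:
  fixes M N :: "nat multiset"
  shows "M \<subseteq># N \<or> N \<subseteq># M \<longleftrightarrow> \<not> clockwise M N \<and> \<not> clockwise N M"
proof
  assume "M \<subseteq># N \<or> N \<subseteq># M"
  then show "\<not> clockwise M N \<and> \<not> clockwise N M"
    by (auto simp: clockwise_def subseteq_mset_def not_less[symmetric])
next
  assume *: "\<not> clockwise M N \<and> \<not> clockwise N M"
  show "M \<subseteq># N \<or> N \<subseteq># M"
  proof (rule ccontr)
    assume "\<not> ?thesis"
    then obtain i j where "count N i < count M i" "count M j < count N j"
      by (auto simp: subseteq_mset_def not_le)
    then show False
      using * clockwise_if_opposite[of i j N M] clockwise_if_opposite[of j i M N]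
      by (cases i j rule: linorder_cases) auto
  qed
qed

section \<open>Swapping adjacent letters\<close>

text \<open>Only the prefix that ends between the two swapped letters is affected by the
  swap.\<close>

lemma trace_ascent_swap:
  fixes a b :: nat
  assumes "a < b" and \<mu>: "\<mu> = x @ [a, b] @ y" and \<nu>: "\<nu> = x @ [b, a] @ y"
  defines "R \<equiv> mset (x @ [a])" and "R' \<equiv> mset (x @ [b])"
  shows "R \<in> trace \<mu>" "trace \<nu> = trace \<mu> - {R} \<union> {R'}" "clockwise R R'"
proof -
  let ?k = "Suc (length x)"
  have eq: "mset (take l \<mu>) = mset (take l \<nu>)" if "l \<noteq> ?k" for l
  proof (cases "l \<le> length x")
    case True
    then show ?thesis by (simp add: \<mu> \<nu>)
  next
    case False
    \<comment> \<open>Such a prefix contains both swapped letters, followed by \<open>m\<close>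
      letters of \<open>y\<close>.\<close>
    define m where "m = l - length x - 2"
    have "l = length x + Suc (Suc m)"
      using False that by (simp add: m_def)
    then show ?thesis by (simp add: \<mu> \<nu>)
  qed
  have k: "mset (take ?k \<mu>) = R" "mset (take ?k \<nu>) = R'"
    by (simp_all add: \<mu> \<nu> R_def R'_def)
  have size: "size R = ?k" "size R' = ?k"
    by (simp_all add: R_def R'_def)
  show "R \<in> trace \<mu>"
    using k size by (simp add: trace_iff)
  show "trace \<nu> = trace \<mu> - {R} \<union> {R'}"
  proof (rule Set.set_eqI)
    fix M show "M \<in> trace \<nu> \<longleftrightarrow> M \<in> trace \<mu> - {R} \<union> {R'}"
      using eq[of "size M"] k size by (cases "size M = ?k") (auto simp: trace_iff)
  qed
  show "clockwise R R'"
    unfolding clockwise_def using \<open>a < b\<close> by (intro exI[of _ a] exI[of _ b]) (auto simp: R_def R'_def)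
qed

text \<open>The traces have one element of each size, so \<open>R\<close> and \<open>R'\<close> have the same size \<open>k\<close>, and the
  words agree except at the positions \<open>k - 1\<close> and \<open>k\<close>.\<close>

lemma ascent_swap_if_trace:
  assumes mset: "mset \<mu> = mset \<nu>" and R: "R \<in> trace \<mu>"
    and tr: "trace \<nu> = trace \<mu> - {R} \<union> {R'}" and cw: "clockwise R R'"
  shows "ascent_swap \<mu> \<nu>"
proof -
  have len: "length \<mu> = length \<nu>"
    using mset by (metis size_mset)
  define k where "k = size R"
  have Rk: "R = mset (take k \<mu>)"
    using R by (simp add: trace_iff k_def)
  have "R \<noteq> R'"
    using cw by (auto simp: clockwise_def)
  have eq: "mset (take l \<mu>) = mset (take l \<nu>)" if "l \<noteq> k" "l \<le> length \<mu>" for l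
  proof -
    have "mset (take l \<mu>) \<noteq> R"
      using that k_def by auto
    then have "mset (take l \<mu>) \<in> trace \<nu>"
      using tr by (auto simp: trace_def)
    then show ?thesis
      using that by (simp add: trace_iff)
  qed
  have kle: "k \<le> length \<mu>"
    by (metis Rk k_def length_take min.cobounded1 size_mset)
  \<comment> \<open>If both prefixes of length \<open>k\<close> had the same multiset,
    \<open>R\<close> would still lie in \<open>trace \<nu>\<close>, although it was exchanged for a
    different element. So this prefix is the new element.\<close>
  have R'k: "R' = mset (take k \<nu>)"
  proof -
    have "mset (take k \<nu>) \<in> trace \<nu>"
      by (auto simp: trace_def)
    moreover have "mset (take k \<nu>) \<noteq> mset (take k \<mu>)"
    proof
      assume same: "mset (take k \<nu>) = mset (take k \<mu>)"
      then have "R \<in> trace \<nu>"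
        unfolding Rk trace_def by (metis rangeI)
      with tr \<open>R \<noteq> R'\<close> show False by auto
    qed
    moreover have "mset (take k \<nu>) \<in> trace \<mu> \<Longrightarrow> mset (take k \<nu>) = mset (take k \<mu>)"
      using kle len by (simp add: trace_iff)
    ultimately show ?thesis
      using tr by auto
  qed
  \<comment> \<open>At both ends the two words have the same prefix multiset, so \<open>k\<close> is
    strictly inside and has a letter on either side.\<close>
  have "k \<noteq> 0"
    using Rk R'k \<open>R \<noteq> R'\<close> by (intro notI) simp
  moreover have "k \<noteq> length \<mu>"
    using Rk R'k \<open>R \<noteq> R'\<close> mset len by (intro notI) simp
  ultimately obtain p where p: "k = Suc p" "Suc p < length \<mu>"
    using kle by (cases k) auto
  have nth: "\<mu> ! l = \<nu> ! l" if "l < length \<mu>" "l \<noteq> p" "l \<noteq> Suc p" for l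
    using that p len by (intro nth_eq_if_mset_take_eq eq) auto
  let ?x = "take p \<mu>" and ?y = "drop (Suc (Suc p)) \<mu>"
  have x: "take p \<nu> = ?x" and y: "drop (Suc (Suc p)) \<nu> = ?y"
    using nth len by (auto intro!: nth_equalityI)
  define a b c d where "a = \<mu> ! p" and "b = \<mu> ! Suc p" and "c = \<nu> ! p" and "d = \<nu> ! Suc p"
  have \<mu>: "?x @ [a, b] @ ?y = \<mu>"
    using p by (simp add: a_def b_def Cons_nth_drop_Suc Suc_lessD)
  have \<nu>: "?x @ [c, d] @ ?y = \<nu>"
    using p len by (simp add: c_def d_def Cons_nth_drop_Suc Suc_lessD flip: x y)
  \<comment> \<open>Cancelling the common outer parts leaves the same two letters in both words;
    \<open>R \<noteq> R'\<close> then forces them to be exchanged.\<close>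
  have "mset (?x @ [a, b] @ ?y) = mset (?x @ [c, d] @ ?y)"
    by (simp only: \<mu> \<nu> mset)
  then have "{#a, b#} = {#c, d#}"
    by simp
  moreover have RR: "R = mset ?x + {#a#}" "R' = mset ?x + {#c#}"
    using Rk R'k p len x by (simp_all add: take_Suc_conv_app_nth a_def c_def)
  ultimately have "c = b" "d = a"
    using \<open>R \<noteq> R'\<close> by (auto simp: add_eq_conv_diff split: if_splits)
  \<comment> \<open>\<open>R\<close> exceeds \<open>R'\<close> only at \<open>a\<close>, and
    \<open>R'\<close> exceeds \<open>R\<close> only at \<open>b\<close>, so these are the
    coordinates in \<open>clockwise\<close>.\<close>
  moreover have "a < b"
    using cw \<open>c = b\<close> unfolding clockwise_def RR by (auto split: if_splits)
  ultimately show ?thesis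
    using \<mu> \<nu> unfolding ascent_swap_def
    by (intro exI[of _ ?x] exI[of _ ?y] exI[of _ a] exI[of _ b]) simp
qed

lemma ascent_swap_iff_trace:
  assumes "mset \<mu> = mset \<nu>"
  shows "ascent_swap \<mu> \<nu> \<longleftrightarrow> (\<exists>R \<in> trace \<mu>. \<exists>R'. trace \<nu> = trace \<mu> - {R} \<union> {R'} \<and> clockwise R R')"
proof
  assume "ascent_swap \<mu> \<nu>"
  then obtain x y a b where "a < b" "\<mu> = x @ [a, b] @ y" "\<nu> = x @ [b, a] @ y"
    by (auto simp: ascent_swap_def)
  from trace_ascent_swap[OF this]
  show "\<exists>R \<in> trace \<mu>. \<exists>R'. trace \<nu> = trace \<mu> - {R} \<union> {R'} \<and> clockwise R R'"
    by blast
qed (use ascent_swap_if_trace[OF assms] in blast)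

lemma mset_ascent_swap: "ascent_swap \<mu> \<nu> \<Longrightarrow> mset \<mu> = mset \<nu>"
  by (auto simp: ascent_swap_def)

text \<open>The first changed letter increases from \<open>a\<close> to \<open>b\<close>.
  Lexicographic growth is what rules out cycles of swaps.\<close>

lemma lexord_ascent_swap: "ascent_swap \<mu> \<nu> \<Longrightarrow> (\<mu>, \<nu>) \<in> lexord less_than"
  by (auto simp: ascent_swap_def intro!: lexord_append_leftI)

lemma antisym_ascent_swap:
  assumes "ascent_swap\<^sup>*\<^sup>* \<mu> \<nu>" "ascent_swap\<^sup>*\<^sup>* \<nu> \<mu>"
  shows "\<mu> = \<nu>"
proof -
  have *: "\<mu> = \<nu> \<or> (\<mu>, \<nu>) \<in> lexord less_than" if "ascent_swap\<^sup>*\<^sup>* \<mu> \<nu>" for \<mu> \<nu>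
    using that
  proof induction
    case (step \<nu> \<rho>)
    then show ?case
      by (metis lexord_ascent_swap lexord_transI transD trans_less_than)
  qed simp
  have "(\<mu>, \<mu>) \<notin> lexord less_than"
    by (simp add: lexord_irreflexive)
  then show ?thesis
    using *[OF assms(1)] *[OF assms(2)] by (meson lexord_transI transD trans_less_than)
qed

section \<open>Multipermutations as the words with a given multiset of letters\<close>

lemma count_sum_replicate_mset:
  "finite A \<Longrightarrow> count (\<Sum>i\<in>A. replicate_mset (g i) i) j = (if j \<in> A then g j else 0)"
  by (simp add: count_sum if_distrib cong: if_cong)

lemma multipermutations_eq:
  "multipermutations n s = {w. mset w = (\<Sum>i = 1..n. replicate_mset (s i) i)}"
proof -
  have "(set w \<subseteq> {1..n} \<and> (\<forall>i \<in> {1..n}. count_list w i = s i)) \<longleftrightarrow>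
      mset w = (\<Sum>i = 1..n. replicate_mset (s i) i)" for w
  proof -
    have "set w \<subseteq> {1..n} \<longleftrightarrow> (\<forall>i. i \<notin> {1..n} \<longrightarrow> count_list w i = 0)"
      by (auto simp: count_list_0_iff)
    then show ?thesis
      unfolding multiset_eq_iff count_sum_replicate_mset[OF finite_atLeastAtMost] count_mset by metis
  qed
  then show ?thesis
    by (simp add: multipermutations_def)
qed

section \<open>Transporting the reflexive-transitive closure\<close>

text \<open>Neither relation leads out of its carrier, so paths can be pushed forward and pulled
  back step by step.\<close>

lemma rtranclp_bij_iff:
  assumes \<phi>: "bij_betw \<phi> A B"
    and rel: "\<And>x y. x \<in> A \<Longrightarrow> y \<in> A \<Longrightarrow> r x y \<longleftrightarrow> r' (\<phi> x) (\<phi> y)"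
    and A: "\<And>x y. r x y \<Longrightarrow> x \<in> A \<Longrightarrow> y \<in> A" and B: "\<And>x y. r' x y \<Longrightarrow> x \<in> B \<Longrightarrow> y \<in> B"
    and x: "x \<in> A" and y: "y \<in> A"
  shows "r\<^sup>*\<^sup>* x y \<longleftrightarrow> r'\<^sup>*\<^sup>* (\<phi> x) (\<phi> y)"
proof
  assume "r\<^sup>*\<^sup>* x y"
  then have "y \<in> A \<and> r'\<^sup>*\<^sup>* (\<phi> x) (\<phi> y)"
  proof induction
    case (step y z)
    then show ?case
      using A rel by (meson rtranclp.rtrancl_into_rtrancl)
  qed (use x in simp)
  then show "r'\<^sup>*\<^sup>* (\<phi> x) (\<phi> y)" ..
next
  have "\<exists>y' \<in> A. z = \<phi> y' \<and> r\<^sup>*\<^sup>* x y'" if "r'\<^sup>*\<^sup>* (\<phi> x) z" for z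
    using that
  proof induction
    case (step u z)
    then obtain u' where u': "u' \<in> A" "u = \<phi> u'" "r\<^sup>*\<^sup>* x u'"
      by blast
    have "z \<in> B"
      using B[OF step.hyps(2)] u' \<phi> by (auto simp: bij_betw_def)
    then obtain z' where "z' \<in> A" "z = \<phi> z'"
      using \<phi> by (auto simp: bij_betw_def)
    moreover have "r u' z'"
      using u' step.hyps(2) rel \<open>z' \<in> A\<close> \<open>z = \<phi> z'\<close> by simp
    ultimately show ?case
      using u'(3) \<open>z = \<phi> z'\<close> by (blast intro: rtranclp.rtrancl_into_rtrancl)
  qed (use x in auto)
  moreover assume "r'\<^sup>*\<^sup>* (\<phi> x) (\<phi> y)"
  ultimately obtain y' where "y' \<in> A" "\<phi> y = \<phi> y'" "r\<^sup>*\<^sup>* x y'"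
    by blast
  then show "r\<^sup>*\<^sup>* x y"
    using \<phi> y by (auto simp: bij_betw_def dest: inj_onD)
qed

text \<open>Antisymmetry is required on the side of \<open>B\<close> only and pulled back to
  \<open>A\<close> along the injective \<open>\<phi>\<close>.\<close>

lemma order_isomorphic_rtranclp:
  assumes \<phi>: "bij_betw \<phi> A B"
    and rel: "\<And>x y. x \<in> A \<Longrightarrow> y \<in> A \<Longrightarrow> r x y \<longleftrightarrow> r' (\<phi> x) (\<phi> y)"
    and A: "\<And>x y. r x y \<Longrightarrow> x \<in> A \<Longrightarrow> y \<in> A" and B: "\<And>x y. r' x y \<Longrightarrow> x \<in> B \<Longrightarrow> y \<in> B"
    and antisym: "\<And>x y. r'\<^sup>*\<^sup>* x y \<Longrightarrow> r'\<^sup>*\<^sup>* y x \<Longrightarrow> x = y"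
  shows "order_isomorphic \<lparr>carrier = A, eq = (=), le = r\<^sup>*\<^sup>*\<rparr> \<lparr>carrier = B, eq = (=), le = r'\<^sup>*\<^sup>*\<rparr>"
proof -
  have iff: "r\<^sup>*\<^sup>* x y \<longleftrightarrow> r'\<^sup>*\<^sup>* (\<phi> x) (\<phi> y)" if "x \<in> A" "y \<in> A" for x y
    using \<phi> rel A B that by (rule rtranclp_bij_iff)
  have A_antisym: "x = y" if "x \<in> A" "y \<in> A" "r'\<^sup>*\<^sup>* (\<phi> x) (\<phi> y)" "r'\<^sup>*\<^sup>* (\<phi> y) (\<phi> x)" for x y
    using antisym[OF that(3,4)] that(1,2) \<phi> by (auto simp: bij_betw_def dest: inj_onD)
  have "weak_partial_order \<lparr>carrier = B, eq = (=), le = r'\<^sup>*\<^sup>*\<rparr>"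
    by unfold_locales (auto intro: antisym)
  moreover have "weak_partial_order \<lparr>carrier = A, eq = (=), le = r\<^sup>*\<^sup>*\<rparr>"
    by unfold_locales
      (auto simp: iff intro: A_antisym)
  ultimately show ?thesis
    unfolding order_isomorphic_def order_emb_def using \<phi> iff by (intro exI[of _ \<phi>]) simp
qed

section \<open>Routes of \<open>oru(s)\<close> as multisets\<close>

lemma is_source_oru_iff: "0 < n \<Longrightarrow> is_source (oru n s) v \<longleftrightarrow> v = 1"
proof
  assume *: "is_source (oru n s) v"
  show "v = 1"
  proof (rule ccontr)
    assume "v \<noteq> 1"
    with * have "(v - 1, 0) \<in> in_arcs (oru n s) v"
      by (auto simp: is_source_def oru_def in_arcs_def)
    with * show False by (auto simp: is_source_def)
  qed
qed (auto simp: is_source_def oru_def in_arcs_def)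

lemma is_sink_oru_iff: "0 < n \<Longrightarrow> is_sink (oru n s) v \<longleftrightarrow> v = n + 1"
proof
  assume *: "is_sink (oru n s) v"
  show "v = n + 1"
  proof (rule ccontr)
    assume "v \<noteq> n + 1"
    with * have "(v, 0) \<in> out_arcs (oru n s) v"
      by (auto simp: is_sink_def oru_def out_arcs_def)
    with * show False by (auto simp: is_sink_def)
  qed
qed (auto simp: is_sink_def oru_def out_arcs_def)

text \<open>Every arc advances by one vertex, so tails along a walk are consecutive. The inequality
  excludes \<open>w < u\<close>, where the interval is empty as well but the empty list is no
  walk.\<close>

lemma cas_oru_iff:
  "pre_digraph.cas (oru n s) u P w \<longleftrightarrow> u \<le> w \<and> map fst P = [u..<w]"
proof (induction P arbitrary: u)
  case Nil
  then show ?case by (auto simp: pre_digraph.cas.simps eq_commute[of "[]"])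
next
  case (Cons e P)
  have "u \<le> w \<and> map fst (e # P) = [u..<w] \<longleftrightarrow> fst e = u \<and> Suc u \<le> w \<and> map fst P = [Suc u..<w]"
    by (cases "u < w") (auto simp: upt_conv_Cons)
  with Cons show ?case
    by (auto simp: pre_digraph.cas.simps oru_def)
qed

lemma awalk_verts_oru:
  "pre_digraph.awalk_verts (oru n s) u P = (if P = [] then [u] else map fst P @ [Suc (fst (last P))])"
  by (simp add: pre_digraph.awalk_verts_conv oru_def)

lemma route_oru_iff:
  assumes "0 < n"
  shows "route (oru n s) P \<longleftrightarrow> map fst P = [1..<n + 1] \<and> set P \<subseteq> arcs (oru n s)"
proof -
  \<comment> \<open>The definition of a route also demands distinct vertices; here they are the
    tails \<open>1, ..., n\<close> followed by \<open>n + 1\<close>.\<close>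
  have "distinct (pre_digraph.awalk_verts (oru n s) 1 P)" if P: "map fst P = [1..<n + 1]"
  proof -
    have "P \<noteq> []"
      using P assms by auto
    then have "fst (last P) = n"
      using P assms by (metis last_map last_upt diff_add_inverse2 zero_less_one less_add_same_cancel2)
    then show ?thesis
      using P \<open>P \<noteq> []\<close> by (simp add: awalk_verts_oru)
  qed
  then show ?thesis
    unfolding route_def is_source_oru_iff[OF assms] is_sink_oru_iff[OF assms]
      pre_digraph.apath_def pre_digraph.awalk_def cas_oru_iff
    by (auto simp: oru_def)
qed

lemma count_sum_list_replicate_mset_eq_0:
  "i \<notin> fst ` set P \<Longrightarrow> count (\<Sum>e\<leftarrow>P. replicate_mset (g e) (fst e)) i = 0"
  by (induction P) auto

lemma count_sum_list_replicate_mset: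
  assumes "distinct (map fst P)" "e \<in> set P"
  shows "count (\<Sum>e\<leftarrow>P. replicate_mset (g e) (fst e)) (fst e) = g e"
  using assms
  by (induction P) (auto simp: count_sum_list_replicate_mset_eq_0 image_iff)

text \<open>Turns the decompositions in \<open>in_less\<close> into positions: as the lists have
  equal length, a common suffix puts \<open>e\<close> and \<open>f\<close> at the same
  index.\<close>

lemma split_common_suffix_iff:
  assumes "length xs = length ys"
  shows "(\<exists>A B C e f. xs = A @ e # C \<and> ys = B @ f # C \<and> R e f) \<longleftrightarrow>
    (\<exists>i < length xs. R (xs ! i) (ys ! i) \<and> (\<forall>k. i < k \<and> k < length xs \<longrightarrow> xs ! k = ys ! k))"
proof
  assume "\<exists>A B C e f. xs = A @ e # C \<and> ys = B @ f # C \<and> R e f"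
  then obtain A B C e f where *: "xs = A @ e # C" "ys = B @ f # C" "R e f"
    by blast
  with assms have len: "length B = length A" by simp
  have "xs ! k = ys ! k" if "length A < k" for k
    using that len by (simp add: * nth_append)
  moreover have "R (xs ! length A) (ys ! length A)" "length A < length xs"
    using * len by (simp_all add: nth_append)
  ultimately show "\<exists>i < length xs. R (xs ! i) (ys ! i) \<and> (\<forall>k. i < k \<and> k < length xs \<longrightarrow> xs ! k = ys ! k)"
    by blast
next
  assume "\<exists>i < length xs. R (xs ! i) (ys ! i) \<and> (\<forall>k. i < k \<and> k < length xs \<longrightarrow> xs ! k = ys ! k)"
  then obtain i where i: "i < length xs" "R (xs ! i) (ys ! i)"
    and eq: "\<And>k. i < k \<Longrightarrow> k < length xs \<Longrightarrow> xs ! k = ys ! k"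
    by blast
  have "drop (Suc i) xs = drop (Suc i) ys"
    using eq assms by (intro nth_equalityI) auto
  then have "ys = take i ys @ ys ! i # drop (Suc i) xs"
    using i(1) assms by (simp flip: id_take_nth_drop)
  moreover have "xs = take i xs @ xs ! i # drop (Suc i) xs"
    using i(1) by (rule id_take_nth_drop)
  ultimately show "\<exists>A B C e f. xs = A @ e # C \<and> ys = B @ f # C \<and> R e f"
    using i(2) by blast
qed

text \<open>The same for \<open>out_less\<close>, where the length of the common prefix is the
  index.\<close>

lemma split_common_prefix_iff:
  assumes "length xs = length ys"
  shows "(\<exists>A B C e f. xs = C @ e # A \<and> ys = C @ f # B \<and> R e f) \<longleftrightarrow>
    (\<exists>i < length xs. R (xs ! i) (ys ! i) \<and> (\<forall>k < i. xs ! k = ys ! k))"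
proof
  assume "\<exists>A B C e f. xs = C @ e # A \<and> ys = C @ f # B \<and> R e f"
  then obtain A B C e f where *: "xs = C @ e # A" "ys = C @ f # B" "R e f"
    by blast
  then have "xs ! k = ys ! k" if "k < length C" for k
    using that by (simp add: nth_append)
  moreover have "R (xs ! length C) (ys ! length C)" "length C < length xs"
    using * by simp_all
  ultimately show "\<exists>i < length xs. R (xs ! i) (ys ! i) \<and> (\<forall>k < i. xs ! k = ys ! k)"
    by blast
next
  assume "\<exists>i < length xs. R (xs ! i) (ys ! i) \<and> (\<forall>k < i. xs ! k = ys ! k)"
  then obtain i where i: "i < length xs" "R (xs ! i) (ys ! i)" and eq: "\<And>k. k < i \<Longrightarrow> xs ! k = ys ! k"
    by blast
  have "take i xs = take i ys"
    using eq i(1) assms by (intro nth_equalityI) auto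
  then have "ys = take i xs @ ys ! i # drop (Suc i) ys"
    using i(1) assms by (simp flip: id_take_nth_drop)
  moreover have "xs = take i xs @ xs ! i # drop (Suc i) xs"
    using i(1) by (rule id_take_nth_drop)
  ultimately show "\<exists>A B C e f. xs = C @ e # A \<and> ys = C @ f # B \<and> R e f"
    using i(2) by blast
qed

section \<open>Heights and ranks of arcs in a planar drawing\<close>

locale planar_oru =
  fixes n :: nat and s :: "nat \<Rightarrow> nat" and d :: "nat \<times> nat \<Rightarrow> real \<Rightarrow> real"
  assumes n_pos: "0 < n" and planar: "planar_drawing (oru n s) d"
begin

abbreviation G :: "(nat, nat \<times> nat) pre_digraph" where
  "G \<equiv> oru n s"

abbreviation F :: "(nat, nat \<times> nat) framing" where
  "F \<equiv> drawing_framing G d"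

text \<open>The midpoint serves as a sample point: parallel arcs do not cross, so their order there
  is their order near both ends.\<close>

definition height :: "nat \<times> nat \<Rightarrow> real" where
  "height e = d e (real (fst e) + 1 / 2)"

text \<open>Ranks are counted from the bottom, so the framing lists arcs by decreasing rank. This makes
  a clockwise exchange an ascent swap of words; ranks from the top would reverse the words.\<close>

definition rank :: "nat \<times> nat \<Rightarrow> nat" where
  "rank e = card {f \<in> arcs G. fst f = fst e \<and> height f < height e}"

definition route_mset :: "(nat \<times> nat) list \<Rightarrow> nat multiset" where
  "route_mset P = (\<Sum>e\<leftarrow>P. replicate_mset (rank e) (fst e))"

text \<open>Both the multiset of letters of every multipermutation and the image under
  \<open>route_mset\<close> of the route along the topmost arcs.\<close>

definition top_mset :: "nat multiset" where
  "top_mset = (\<Sum>i = 1..n. replicate_mset (s i) i)"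

lemma arcs_oru [simp]: "arcs G = (SIGMA i : {1..n}. {0..s i})"
  and tail_oru [simp]: "tail G = fst" and head_oru [simp]: "head G e = Suc (fst e)"
  by (simp_all add: oru_def)

lemma drawing_continuous:
  assumes "e \<in> arcs G" shows "continuous_on {real (fst e)<..<real (fst e) + 1} (d e)"
  by (rule continuous_on_subset[of "{real (tail G e)..real (head G e)}"])
    (use planar assms in \<open>auto simp: planar_drawing_def\<close>)

lemma drawing_neq:
  assumes "e \<in> arcs G" "f \<in> arcs G" "fst e = fst f" "e \<noteq> f"
    and "real (fst e) < x" "x < real (fst e) + 1"
  shows "d e x \<noteq> d f x"
proof -
  have "real (tail G e) < x" "x < real (head G e)" "real (tail G f) < x" "x < real (head G f)"
    using assms by auto
  then show ?thesis
    using planar assms(1,2,4) unfolding planar_drawing_def by blast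
qed

text \<open>The difference of two parallel arcs is continuous and has no zero over the open
  interval, so it keeps its sign.\<close>

lemma drawing_less_iff:
  assumes ef: "e \<in> arcs G" "f \<in> arcs G" "fst e = fst f" "e \<noteq> f"
    and x: "real (fst e) < x" "x < real (fst e) + 1"
  shows "d f x < d e x \<longleftrightarrow> height f < height e"
proof -
  have "continuous_on {real (fst e)<..<real (fst e) + 1} (\<lambda>x. d e x - d f x)"
    using drawing_continuous ef(1,2) ef(3) by (metis continuous_on_diff)
  moreover have "d e x - d f x \<noteq> 0" if "real (fst e) < x" "x < real (fst e) + 1" for x
    using drawing_neq[OF ef that] by simp
  ultimately have "(\<forall>x. real (fst e) < x \<and> x < real (fst e) + 1 \<longrightarrow> d e x - d f x < 0) \<or>
      (\<forall>x. real (fst e) < x \<and> x < real (fst e) + 1 \<longrightarrow> 0 < d e x - d f x)"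
    by (rule no_crossing_sign)
  then show ?thesis
  proof
    assume *: "\<forall>x. real (fst e) < x \<and> x < real (fst e) + 1 \<longrightarrow> d e x - d f x < 0"
    show ?thesis
      using *[rule_format, of x] *[rule_format, of "real (fst e) + 1 / 2"] x ef(3)
      by (simp add: height_def)
  next
    assume *: "\<forall>x. real (fst e) < x \<and> x < real (fst e) + 1 \<longrightarrow> 0 < d e x - d f x"
    show ?thesis
      using *[rule_format, of x] *[rule_format, of "real (fst e) + 1 / 2"] x ef(3)
      by (simp add: height_def)
  qed
qed

lemma height_inj:
  assumes "e \<in> arcs G" "f \<in> arcs G" "fst e = fst f" "height e = height f"
  shows "e = f"
  using drawing_neq[OF assms(1-3), of "real (fst e) + 1 / 2"] assms(3,4) by (auto simp: height_def)

text \<open>The arcs below the lower arc are also below the higher one, and the lower arc itself is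
  one more.\<close>

lemma rank_less_iff:
  assumes ef: "e \<in> arcs G" "f \<in> arcs G" "fst e = fst f"
  shows "rank f < rank e \<longleftrightarrow> height f < height e"
proof -
  have *: "rank f < rank e" if "e \<in> arcs G" "f \<in> arcs G" "fst e = fst f" "height f < height e" for e f
    unfolding rank_def using that by (intro psubset_card_mono) auto
  show ?thesis
    using *[OF ef] *[OF ef(2,1) ef(3)[symmetric]] height_inj[OF ef]
    by (metis less_asym linorder_neqE_linordered_idom less_irrefl)
qed

lemma rank_inj:
  assumes "e \<in> arcs G" "f \<in> arcs G" "fst e = fst f" "rank e = rank f"
  shows "e = f"
  using rank_less_iff[OF assms(1-3)] rank_less_iff[OF assms(2,1) assms(3)[symmetric]]
    height_inj[OF assms(1-3)] assms(4) by linarith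

text \<open>By counting: \<open>s i + 1\<close> parallel arcs have distinct ranks, none above
  \<open>s i\<close>.\<close>

lemma rank_image:
  assumes i: "i \<in> {1..n}"
  shows "rank ` {e \<in> arcs G. fst e = i} = {0..s i}"
proof (rule card_subset_eq)
  have A: "{e \<in> arcs G. fst e = i} = {i} \<times> {0..s i}"
    using i by auto
  show "rank ` {e \<in> arcs G. fst e = i} \<subseteq> {0..s i}"
  proof
    fix r assume "r \<in> rank ` {e \<in> arcs G. fst e = i}"
    then obtain e where e: "e \<in> arcs G" "fst e = i" "r = rank e"
      by auto
    \<comment> \<open>An arc is not below itself, so the inclusion of sets is strict.\<close>
    then have "r < card {f \<in> arcs G. fst f = i}"
      unfolding rank_def e(3) by (intro psubset_card_mono) auto
    then show "r \<in> {0..s i}"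
      unfolding A by (simp add: card_cartesian_product)
  qed
  have "inj_on rank {e \<in> arcs G. fst e = i}"
    by (intro inj_onI) (use rank_inj in auto)
  then show "card (rank ` {e \<in> arcs G. fst e = i}) = card {0..s i}"
    unfolding A by (simp add: card_image card_cartesian_product)
qed simp

text \<open>Close to the head all points lie over the open interval without crossings, so the
  eventual comparison becomes a comparison of heights, independent of the point.\<close>

lemma in_ord_iff:
  assumes "e \<in> arcs G" "f \<in> arcs G" "fst e = fst f" "e \<noteq> f"
  shows "(e, f) \<in> in_ord F (Suc (fst e)) \<longleftrightarrow> rank f < rank e"
proof -
  have "\<forall>\<^sub>F x in at_left (real (Suc (fst e))). d f x < d e x \<longleftrightarrow> height f < height e"
    by (rule eventually_mono[OF eventually_at_left_real[of "real (fst e)"]])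
      (use drawing_less_iff[OF assms] in auto)
  then have "(\<forall>\<^sub>F x in at_left (real (Suc (fst e))). d f x < d e x) \<longleftrightarrow>
      (\<forall>\<^sub>F x in at_left (real (Suc (fst e))). height f < height e)"
    by (rule eventually_subst)
  then show ?thesis
    using assms by (auto simp: drawing_framing_def in_arcs_def rank_less_iff)
qed

lemma out_ord_iff:
  assumes "e \<in> arcs G" "f \<in> arcs G" "fst e = fst f" "e \<noteq> f"
  shows "(e, f) \<in> out_ord F (fst e) \<longleftrightarrow> rank f < rank e"
proof -
  have "\<forall>\<^sub>F x in at_right (real (fst e)). d f x < d e x \<longleftrightarrow> height f < height e"
    by (rule eventually_mono[OF eventually_at_right_real[of _ "real (fst e) + 1"]])
      (use drawing_less_iff[OF assms] in auto)
  then have "(\<forall>\<^sub>F x in at_right (real (fst e)). d f x < d e x) \<longleftrightarrow>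
      (\<forall>\<^sub>F x in at_right (real (fst e)). height f < height e)"
    by (rule eventually_subst)
  then show ?thesis
    using assms by (auto simp: drawing_framing_def out_arcs_def rank_less_iff)
qed

section \<open>Coordinates of a single route\<close>

context
  fixes P assumes P: "route G P"
begin

lemma map_fst_route: "map fst P = [1..<n + 1]"
  using P route_oru_iff[OF n_pos] by blast

lemma set_route: "set P \<subseteq> arcs G"
  using P route_oru_iff[OF n_pos] by blast

lemma length_route: "length P = n"
  using arg_cong[OF map_fst_route, of length] by simp

text \<open>Lists are indexed from 0 and vertices from 1, hence the shift by \<open>Suc\<close> from
  here on.\<close>

lemma fst_nth_route:
  assumes "i < n" shows "fst (P ! i) = Suc i"
proof -
  have "fst (P ! i) = map fst P ! i"
    using assms length_route by simp
  also have "\<dots> = Suc i"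
    unfolding map_fst_route using assms by (simp del: upt_Suc)
  finally show ?thesis .
qed

lemma nth_route: "i < n \<Longrightarrow> P ! i \<in> arcs G"
  using set_route length_route nth_mem by blast

lemma count_route_mset:
  assumes "i < n" shows "count (route_mset P) (Suc i) = rank (P ! i)"
  using assms count_sum_list_replicate_mset[of P "P ! i" rank] map_fst_route
  by (simp add: route_mset_def fst_nth_route length_route del: upt_Suc)

lemma count_route_mset_eq_0:
  assumes "i \<notin> {1..n}" shows "count (route_mset P) i = 0"
proof -
  have "fst ` set P = {1..n}"
    using arg_cong[OF map_fst_route, of set] by auto
  then show ?thesis
    unfolding route_mset_def using assms by (simp add: count_sum_list_replicate_mset_eq_0)
qed

lemma path_to_route: "m < n \<Longrightarrow> path_to G (Suc m) P = take m P"
  unfolding path_to_def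
  by (rule takeWhile_eq_take_P_nth) (auto simp: length_route fst_nth_route)

lemma path_from_route:
  assumes "m < n" shows "path_from G (Suc m) P = drop m P"
  using path_to_route[OF assms] length_route assms
  unfolding path_to_def path_from_def dropWhile_eq_drop by simp

lemma inner_verts_route: "set (pre_digraph.inner_verts G P) = {2..n}"
  unfolding pre_digraph.inner_verts_def tail_oru map_fst_route
  using n_pos by (auto simp: upt_conv_Cons simp del: upt_Suc)

end

lemma count_top_mset: "count top_mset i = (if i \<in> {1..n} then s i else 0)"
  by (simp add: top_mset_def count_sum_replicate_mset)

lemma rank_le: "e \<in> arcs G \<Longrightarrow> rank e \<le> s (fst e)"
  using rank_image[of "fst e"] by fastforce

lemma route_mset_eq_iff:
  assumes P: "route G P" and Q: "route G Q" and i: "i < n"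
  shows "P ! i = Q ! i \<longleftrightarrow> count (route_mset P) (Suc i) = count (route_mset Q) (Suc i)"
  using rank_inj[OF nth_route[OF P i] nth_route[OF Q i]]
  by (auto simp: count_route_mset[OF P i] count_route_mset[OF Q i] fst_nth_route[OF P i] fst_nth_route[OF Q i])

text \<open>Each count determines the arc of that rank, which gives injectivity; every number up to
  \<open>s i\<close> is a rank, which gives surjectivity.\<close>

lemma bij_betw_route_mset: "bij_betw route_mset {P. route G P} {M. M \<subseteq># top_mset}"
proof (rule bij_betw_imageI)
  show "inj_on route_mset {P. route G P}"
    by (intro inj_onI nth_equalityI) (auto simp: length_route route_mset_eq_iff)
  have "route_mset P \<subseteq># top_mset" if P: "route G P" for P
  proof (rule mset_subset_eqI)
    fix i show "count (route_mset P) i \<le> count top_mset i"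
    proof (cases "i \<in> {1..n}")
      case True
      then obtain l where "i = Suc l" "l < n"
        by (cases i) auto
      then show ?thesis
        using rank_le[OF nth_route[OF P, of l]]
        by (simp add: count_top_mset count_route_mset[OF P] fst_nth_route[OF P])
    qed (simp add: count_route_mset_eq_0[OF P])
  qed
  moreover have "M \<in> route_mset ` {P. route G P}" if M: "M \<subseteq># top_mset" for M
  proof -
    have "\<exists>e. e \<in> arcs G \<and> fst e = i \<and> rank e = count M i" if i: "i \<in> {1..n}" for i
    proof -
      have "count M i \<le> s i"
        using mset_subset_eq_count[OF M, of i] i by (simp add: count_top_mset split: if_splits)
      then have "count M i \<in> rank ` {e \<in> arcs G. fst e = i}"
        unfolding rank_image[OF i] by simp
      then show ?thesis
        by fastforce
    qed
    \<comment> \<open>\<open>a i\<close> is the arc leaving \<open>i\<close> whose rank is the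
      prescribed count; these arcs in order form the preimage of \<open>M\<close>.\<close>
    then obtain a where a: "\<And>i. i \<in> {1..n} \<Longrightarrow> a i \<in> arcs G \<and> fst (a i) = i \<and> rank (a i) = count M i"
      by metis
    define P where "P = map a [1..<n + 1]"
    have "map fst P = [1..<n + 1]"
      unfolding P_def map_map by (rule map_idI) (use a in auto)
    moreover have "set P \<subseteq> arcs G"
      unfolding P_def using a by (auto simp del: arcs_oru)
    ultimately have P: "route G P"
      unfolding route_oru_iff[OF n_pos] by blast
    have "route_mset P = M"
    proof (rule multiset_eqI)
      fix i show "count (route_mset P) i = count M i"
      proof (cases "i \<in> {1..n}")
        case True
        then obtain l where l: "i = Suc l" "l < n"
          by (cases i) auto
        then have "P ! l = a i"
          by (simp add: P_def del: upt_Suc)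
        then show ?thesis
          using a[OF True] l by (simp add: count_route_mset[OF P])
      next
        case False
        then show ?thesis
          using mset_subset_eq_count[OF M, of i]
          by (simp add: count_route_mset_eq_0[OF P] count_top_mset split: if_splits)
      qed
    qed
    with P show ?thesis by blast
  qed
  ultimately show "route_mset ` {P. route G P} = {M. M \<subseteq># top_mset}"
    by blast
qed

section \<open>Coherence is comparability\<close>

text \<open>The arcs before vertex \<open>Suc m\<close> are those at positions below
  \<open>m\<close>, and the last difference among them decides. Smaller in the framing means larger
  in rank.\<close>

lemma in_less_iff:
  assumes P: "route G P" and Q: "route G Q" and m: "m < n"
  shows "in_less G F (Suc m) P Q \<longleftrightarrow>
    (\<exists>i < m. rank (Q ! i) < rank (P ! i) \<and> (\<forall>k. i < k \<and> k < m \<longrightarrow> P ! k = Q ! k))"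
proof -
  have "in_less G F (Suc m) P Q \<longleftrightarrow> (\<exists>A B C e f. take m P = A @ e # C \<and> take m Q = B @ f # C \<and>
     (e \<noteq> f \<and> fst e = fst f \<and> (e, f) \<in> in_ord F (Suc (fst e))))"
    unfolding in_less_def path_to_route[OF P m] path_to_route[OF Q m] by simp
  also have "\<dots> \<longleftrightarrow> (\<exists>i < m. (P ! i \<noteq> Q ! i \<and> fst (P ! i) = fst (Q ! i) \<and>
      (P ! i, Q ! i) \<in> in_ord F (Suc (fst (P ! i)))) \<and> (\<forall>k. i < k \<and> k < m \<longrightarrow> P ! k = Q ! k))"
    using m by (subst split_common_suffix_iff) (auto simp: length_route[OF P] length_route[OF Q])
  also have "\<dots> \<longleftrightarrow> (\<exists>i < m. rank (Q ! i) < rank (P ! i) \<and> (\<forall>k. i < k \<and> k < m \<longrightarrow> P ! k = Q ! k))"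
  proof -
    have "(P ! i \<noteq> Q ! i \<and> fst (P ! i) = fst (Q ! i) \<and> (P ! i, Q ! i) \<in> in_ord F (Suc (fst (P ! i)))) \<longleftrightarrow>
        rank (Q ! i) < rank (P ! i)" if "i < m" for i
      using in_ord_iff[of "P ! i" "Q ! i"] that m nth_route[OF P, of i] nth_route[OF Q, of i]
        fst_nth_route[OF P, of i] fst_nth_route[OF Q, of i] by fastforce
    then show ?thesis by blast
  qed
  finally show ?thesis .
qed

lemma out_less_iff:
  assumes P: "route G P" and Q: "route G Q" and m: "m < n"
  shows "out_less G F (Suc m) P Q \<longleftrightarrow>
    (\<exists>j \<ge> m. j < n \<and> rank (Q ! j) < rank (P ! j) \<and> (\<forall>k. m \<le> k \<and> k < j \<longrightarrow> P ! k = Q ! k))"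
proof -
  have "out_less G F (Suc m) P Q \<longleftrightarrow> (\<exists>A B C e f. drop m P = C @ e # A \<and> drop m Q = C @ f # B \<and>
     (e \<noteq> f \<and> fst e = fst f \<and> (e, f) \<in> out_ord F (fst e)))"
    unfolding out_less_def path_from_route[OF P m] path_from_route[OF Q m] by simp
  also have "\<dots> \<longleftrightarrow> (\<exists>j < n - m. (P ! (m + j) \<noteq> Q ! (m + j) \<and> fst (P ! (m + j)) = fst (Q ! (m + j)) \<and>
      (P ! (m + j), Q ! (m + j)) \<in> out_ord F (fst (P ! (m + j)))) \<and> (\<forall>k < j. P ! (m + k) = Q ! (m + k)))"
    using m by (subst split_common_prefix_iff) (auto simp: length_route[OF P] length_route[OF Q])
  also have "\<dots> \<longleftrightarrow> (\<exists>j < n - m. rank (Q ! (m + j)) < rank (P ! (m + j)) \<and> (\<forall>k < j. P ! (m + k) = Q ! (m + k)))"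
  proof -
    have "(P ! i \<noteq> Q ! i \<and> fst (P ! i) = fst (Q ! i) \<and> (P ! i, Q ! i) \<in> out_ord F (fst (P ! i))) \<longleftrightarrow>
        rank (Q ! i) < rank (P ! i)" if "i < n" for i
      using out_ord_iff[of "P ! i" "Q ! i"] that nth_route[OF P, of i] nth_route[OF Q, of i]
        fst_nth_route[OF P, of i] fst_nth_route[OF Q, of i] by fastforce
    moreover have "m + j < n" if "j < n - m" for j
      using that by simp
    ultimately show ?thesis
      by blast
  qed
  \<comment> \<open>Positions in \<open>drop m P\<close> are shifted to positions in
    \<open>P\<close>.\<close>
  also have "\<dots> \<longleftrightarrow> (\<exists>j \<ge> m. j < n \<and> rank (Q ! j) < rank (P ! j) \<and> (\<forall>k. m \<le> k \<and> k < j \<longrightarrow> P ! k = Q ! k))"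
    (is "(\<exists>j < n - m. ?R j) \<longleftrightarrow> (\<exists>j \<ge> m. ?R' j)")
  proof
    assume "\<exists>j < n - m. ?R j"
    then obtain j where j: "j < n - m" "?R j"
      by blast
    have "P ! k = Q ! k" if "m \<le> k" "k < m + j" for k
      using that j(2) le_Suc_ex[OF that(1)] by auto
    with j show "\<exists>j \<ge> m. ?R' j"
      by (intro exI[of _ "m + j"]) auto
  next
    assume "\<exists>j \<ge> m. ?R' j"
    then obtain j where "j \<ge> m" "?R' j"
      by blast
    then show "\<exists>j < n - m. ?R j"
      by (intro exI[of _ "j - m"]) auto
  qed
  finally show ?thesis .
qed

text \<open>The decisive differences before and after a common vertex are opposite, with agreement
  in between. Conversely, the coordinates in \<open>clockwise\<close> enclose a suitable
  vertex.\<close>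

lemma cw_less_iff_clockwise:
  assumes P: "route G P" and Q: "route G Q"
  shows "(\<exists>v. cw_less G F v P Q) \<longleftrightarrow> clockwise (route_mset P) (route_mset Q)"
proof
  assume "\<exists>v. cw_less G F v P Q"
  then obtain v where v: "cw_less G F v P Q"
    by blast
  then have "v \<in> {2..n}"
    unfolding cw_less_def inner_verts_route[OF P] by blast
  then obtain m where m: "v = Suc m" "m < n"
    by (cases v) auto
  obtain i j where i: "i < m" "rank (Q ! i) < rank (P ! i)" "\<forall>k. i < k \<and> k < m \<longrightarrow> P ! k = Q ! k"
    and j: "m \<le> j" "j < n" "rank (P ! j) < rank (Q ! j)" "\<forall>k. m \<le> k \<and> k < j \<longrightarrow> Q ! k = P ! k"
    using v unfolding cw_less_def m(1) in_less_iff[OF P Q m(2)] out_less_iff[OF Q P m(2)] by blast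
  have "count (route_mset P) k = count (route_mset Q) k" if k: "Suc i < k" "k < Suc j" for k
  proof -
    obtain l where l: "k = Suc l"
      using k(1) by (cases k) auto
    with k i(3) j(4) have "P ! l = Q ! l"
      by (cases "l < m") auto
    moreover have "l < n"
      using l k(2) j(2) by simp
    ultimately show ?thesis
      by (simp add: l count_route_mset[OF P] count_route_mset[OF Q])
  qed
  then show "clockwise (route_mset P) (route_mset Q)"
    unfolding clockwise_def using i(1,2) j(1-3)
    by (intro exI[of _ "Suc i"] exI[of _ "Suc j"]) (simp add: count_route_mset[OF P] count_route_mset[OF Q])
next
  assume "clockwise (route_mset P) (route_mset Q)"
  then obtain i j where ij: "i < j"
    and i: "count (route_mset Q) i < count (route_mset P) i"
    and j: "count (route_mset P) j < count (route_mset Q) j"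
    and eq: "\<And>k. i < k \<Longrightarrow> k < j \<Longrightarrow> count (route_mset P) k = count (route_mset Q) k"
    by (auto simp: clockwise_def)
  have "i \<in> {1..n}" "j \<in> {1..n}"
    using i j count_route_mset_eq_0[OF P, of i] count_route_mset_eq_0[OF Q, of j] by fastforce+
  then obtain a b where ab: "i = Suc a" "j = Suc b" "a < n" "b < n"
    by (cases i; cases j) auto
  have "P ! k = Q ! k" if "a < k" "k < b" for k
    using that eq[of "Suc k"] route_mset_eq_iff[OF P Q, of k] ab by simp
  \<comment> \<open>The vertex chosen is \<open>j = Suc b\<close>: the routes differ on leaving it,
    and \<open>i < j\<close> makes it an inner vertex.\<close>
  then have "in_less G F (Suc b) P Q"
    unfolding in_less_iff[OF P Q ab(4)] using ij i ab
    by (intro exI[of _ a]) (auto simp: count_route_mset[OF P] count_route_mset[OF Q])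
  moreover have "out_less G F (Suc b) Q P"
    unfolding out_less_iff[OF Q P ab(4)] using j ab
    by (intro exI[of _ b]) (auto simp: count_route_mset[OF P] count_route_mset[OF Q])
  ultimately have "cw_less G F (Suc b) P Q"
    unfolding cw_less_def inner_verts_route[OF P] inner_verts_route[OF Q] using ij ab by simp
  then show "\<exists>v. cw_less G F v P Q" ..
qed

lemma coherent_iff:
  assumes "route G P" "route G Q"
  shows "coherent G F P Q \<longleftrightarrow> route_mset P \<subseteq># route_mset Q \<or> route_mset Q \<subseteq># route_mset P"
  unfolding coherent_def comparable_iff_not_clockwise
  using cw_less_iff_clockwise[OF assms] cw_less_iff_clockwise[OF assms(2,1)] by blast

section \<open>Maximal cliques as maximal chains\<close>

lemma clique_iff:
  "clique G F C \<longleftrightarrow> C \<subseteq> {P. route G P} \<and> mset_chain top_mset (route_mset ` C)"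
proof -
  have top: "route_mset P \<subseteq># top_mset" if "route G P" for P
    using that bij_betwE[OF bij_betw_route_mset] by blast
  have "mset_chain top_mset (route_mset ` C) \<longleftrightarrow>
      (\<forall>P \<in> C. \<forall>Q \<in> C. route_mset P \<subseteq># route_mset Q \<or> route_mset Q \<subseteq># route_mset P)"
    if "\<forall>P \<in> C. route G P"
    unfolding mset_chain_iff ball_simps using that top by blast
  moreover have "coherent G F P Q \<longleftrightarrow> route_mset P \<subseteq># route_mset Q \<or> route_mset Q \<subseteq># route_mset P"
    if "\<forall>P \<in> C. route G P" "P \<in> C" "Q \<in> C" for P Q
    using that coherent_iff by blast
  ultimately show ?thesis
    unfolding clique_def subset_iff mem_Collect_eq by (metis (no_types, lifting))
qed

text \<open>Every chain of submultisets is the image of a set of routes, and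
  \<open>route_mset\<close> is injective, so proper extensions of a clique and of its image
  correspond.\<close>

lemma max_clique_iff:
  "max_clique G F C \<longleftrightarrow> C \<subseteq> {P. route G P} \<and> mset_maxchain top_mset (route_mset ` C)"
proof (cases "C \<subseteq> {P. route G P}")
  case True
  note inj = bij_betw_imp_inj_on[OF bij_betw_route_mset]
  have sub: "route_mset ` C \<subset> route_mset ` D \<longleftrightarrow> C \<subset> D" if D: "D \<subseteq> {P. route G P}" for D
  proof
    assume *: "route_mset ` C \<subset> route_mset ` D"
    have "C \<subseteq> D"
    proof
      fix P assume "P \<in> C"
      with * obtain Q where "Q \<in> D" "route_mset P = route_mset Q"
        by blast
      then show "P \<in> D"
        using inj_onD[OF inj, of P Q] D True \<open>P \<in> C\<close> by blast
    qed
    with * show "C \<subset> D" by blast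
  qed (auto simp: psubset_eq inj_on_image_eq_iff[OF inj True D])
  have "(\<exists>D. clique G F D \<and> C \<subset> D) \<longleftrightarrow> (\<exists>S. mset_chain top_mset S \<and> route_mset ` C \<subset> S)"
  proof
    assume "\<exists>D. clique G F D \<and> C \<subset> D"
    then obtain D where D: "D \<subseteq> {P. route G P}" "mset_chain top_mset (route_mset ` D)" "C \<subset> D"
      unfolding clique_iff by blast
    then show "\<exists>S. mset_chain top_mset S \<and> route_mset ` C \<subset> S"
      by (intro exI[of _ "route_mset ` D"] conjI iffD2[OF sub])
  next
    assume "\<exists>S. mset_chain top_mset S \<and> route_mset ` C \<subset> S"
    then obtain S where S: "mset_chain top_mset S" "route_mset ` C \<subset> S"
      by blast
    then have "S \<subseteq> route_mset ` {P. route G P}"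
      unfolding bij_betw_imp_surj_on[OF bij_betw_route_mset] by (auto simp: mset_chain_iff)
    then obtain D where D: "D \<subseteq> {P. route G P}" "S = route_mset ` D"
      unfolding subset_image_iff by (elim exE conjE)
    then have "clique G F D" "C \<subset> D"
      using S sub[OF D(1)] by (simp_all add: clique_iff)
    then show "\<exists>D. clique G F D \<and> C \<subset> D"
      by blast
  qed
  moreover have "max_clique G F C \<longleftrightarrow> clique G F C \<and> \<not> (\<exists>D. clique G F D \<and> C \<subset> D)"
    unfolding max_clique_def by blast
  ultimately show ?thesis
    using True by (simp add: clique_iff[of C] pred_on.maxchain_def)
qed (auto simp: max_clique_def clique_def)

section \<open>Words of maximal cliques and the cover relation\<close>

text \<open>The inverse of \<open>trace\<close> has the intended meaning for maximal cliques, whose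
  images are maximal chains and thus traces.\<close>

definition word :: "(nat \<times> nat) list set \<Rightarrow> nat list" where
  "word C = inv_into {w. mset w = top_mset} trace (route_mset ` C)"

lemma bij_betw_image_route_mset:
  "bij_betw ((`) route_mset) {C. max_clique G F C} {C. mset_maxchain top_mset C}"
proof (rule bij_betw_subset[OF bij_betw_Pow[OF bij_betw_route_mset]])
  show "(`) route_mset ` {C. max_clique G F C} = {C. mset_maxchain top_mset C}"
  proof (intro equalityI subsetI)
    fix S assume S: "S \<in> {C. mset_maxchain top_mset C}"
    then have "S \<subseteq> route_mset ` {P. route G P}"
      unfolding bij_betw_imp_surj_on[OF bij_betw_route_mset]
      by (auto simp: pred_on.maxchain_def mset_chain_iff)
    then obtain D where "D \<subseteq> {P. route G P}" "S = route_mset ` D"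
      unfolding subset_image_iff by (elim exE conjE)
    with S show "S \<in> (`) route_mset ` {C. max_clique G F C}"
      by (auto simp: max_clique_iff)
  qed (auto simp: max_clique_iff)
qed (auto simp: max_clique_iff)

lemma bij_betw_word: "bij_betw word {C. max_clique G F C} {w. mset w = top_mset}"
  unfolding word_def
  using bij_betw_trans[OF bij_betw_image_route_mset bij_betw_inv_into[OF bij_betw_trace]]
  by (simp add: comp_def)

lemma trace_word:
  assumes "max_clique G F C" shows "trace (word C) = route_mset ` C"
proof -
  have "route_mset ` C \<in> trace ` {w. mset w = top_mset}"
    using assms bij_betw_trace[of top_mset] by (auto simp: bij_betw_def max_clique_iff)
  then show ?thesis
    unfolding word_def by (rule f_inv_into_f)
qed

lemma clique_cover_iff:
  assumes C: "max_clique G F C" and C': "max_clique G F C'"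
  shows "clique_cover G F C C' \<longleftrightarrow> ascent_swap (word C) (word C')"
proof -
  have sub: "C \<subseteq> {P. route G P}" "C' \<subseteq> {P. route G P}"
    using C C' by (auto simp: max_clique_iff)
  have inj: "inj_on route_mset {P. route G P}"
    using bij_betw_route_mset by (rule bij_betw_imp_inj_on)
  have "mset (word C) = mset (word C')"
    using C C' bij_betwE[OF bij_betw_word] by simp
  note iff = ascent_swap_iff_trace[OF this, unfolded trace_word[OF C] trace_word[OF C']]
  \<comment> \<open>By injectivity, an exchange of routes can be tested on the multisets.\<close>
  have exch: "C' = C - {R} \<union> {R'} \<longleftrightarrow> route_mset ` C' = route_mset ` C - {route_mset R} \<union> {route_mset R'}"
    if "R \<in> C" "route G R'" for R R'
  proof -
    have "C - {R} \<subseteq> {P. route G P}" "{R} \<subseteq> {P. route G P}"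
      using sub that by blast+
    from inj_on_image_set_diff[OF inj this]
    have *: "route_mset ` (C - {R} \<union> {R'}) = route_mset ` C - {route_mset R} \<union> {route_mset R'}"
      by (simp add: image_Un)
    have "C - {R} \<union> {R'} \<subseteq> {P. route G P}"
      using sub that by blast
    from inj_on_image_eq_iff[OF inj sub(2) this] show ?thesis
      unfolding * by blast
  qed
  show ?thesis
  proof
    assume "clique_cover G F C C'"
    then obtain R R' u where R: "R \<in> C" "C' = C - {R} \<union> {R'}" "cw_less G F u R R'"
      by (auto simp: clique_cover_def)
    then have "route G R" "route G R'"
      using sub by blast+
    then have "clockwise (route_mset R) (route_mset R')"
      using R(3) cw_less_iff_clockwise by blast
    then show "ascent_swap (word C) (word C')"
      unfolding iff using R exch[OF R(1) \<open>route G R'\<close>] by blast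
  next
    assume "ascent_swap (word C) (word C')"
    then obtain R M' where R: "R \<in> C" and M': "route_mset ` C' = route_mset ` C - {route_mset R} \<union> {M'}"
      "clockwise (route_mset R) M'"
      unfolding iff by blast
    \<comment> \<open>The new multiset \<open>M'\<close> lies in the image of \<open>C'\<close>, so
      it comes from a route.\<close>
    then obtain R' where R': "R' \<in> C'" "M' = route_mset R'"
      by blast
    then have "route G R" "route G R'"
      using sub R by blast+
    then obtain u where "cw_less G F u R R'"
      using M'(2) R'(2) cw_less_iff_clockwise by blast
    then show "clique_cover G F C C'"
      unfolding clique_cover_def using C C' R exch[OF R \<open>route G R'\<close>] M'(1) R'(2) by blast
  qed
qed

lemma order_isomorphic_multipermutations:
  "order_isomorphic (framing_lattice G F) (multipermutation_lattice n s)"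
proof -
  have M: "multipermutations n s = {w. mset w = top_mset}"
    by (simp add: multipermutations_eq top_mset_def)
  show ?thesis
    unfolding framing_lattice_def multipermutation_lattice_def M
    using bij_betw_word
  proof (rule order_isomorphic_rtranclp)
    show "clique_cover G F C C' \<longleftrightarrow> ascent_swap (word C) (word C')"
      if "C \<in> {C. max_clique G F C}" "C' \<in> {C. max_clique G F C}" for C C'
      using that clique_cover_iff by simp
  qed (auto simp: clique_cover_def mset_ascent_swap intro: antisym_ascent_swap)
qed

end

theorem theorem9p1:
  fixes N n :: nat and s :: "nat \<Rightarrow> nat" and d :: "nat \<times> nat \<Rightarrow> real \<Rightarrow> real"
    and F :: "(nat, nat \<times> nat) framing"
  assumes "0 < N" and "composition N n s"
    and "planar_drawing (oru n s) d" and "F = drawing_framing (oru n s) d"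
  shows "order_isomorphic (framing_lattice (oru n s) F) (multipermutation_lattice n s)"
proof -
  \<comment> \<open>For \<open>n = 0\<close> the sum of the parts would be 0 instead of the positive
    \<open>N\<close>.\<close>
  have "0 < n"
    using assms(1,2) by (cases n) (auto simp: composition_def)
  then interpret planar_oru n s d
    using assms(3) by unfold_locales
  show ?thesis
    unfolding assms(4) by (rule order_isomorphic_multipermutations)
qed

end
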